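(* Let $\mathbb{K}$ be $\mathbb{R}$ or $\mathbb{C}$, let $M\in\mathbb{K}^{p\times p}$ be invertible, and let $\mathcal{A},\mathcal{B}\in\mathbb{K}^{n\times n\times p}$ be $*_M$-pseudo-positive-definite. Then the geometric mean $\mathcal{A}\#_{*_M}\mathcal{B}$ is the unique $*_M$-pseudo-positive-definite solution $\mathcal{X}\in\mathbb{K}^{n\times n\times p}$ of the Riccati tensor equation $$\mathcal{X}*_M\mathcal{A}^{-1}*_M\mathcal{X}=\mathcal{B}.$$
   Context: Mode-3 product: for $\mathcal{A}=[a_{ijk}]\in\mathbb{K}^{m\times n\times p}$ and $N=[n_{kl}]\in\mathbb{K}^{r\times p}$, $(\mathcal{A}\times_3 N)_{ijk}=\sum_{l=1}^p n_{kl}a_{ijl}$. The $i$-th frontal slice $\mathcal{A}^{(i)}$ is the $m\times n$ matrix with entries $a_{\cdot\,\cdot\, i}$. Face-wise product: $(\mathcal{A}\triangle\mathcal{B})^{(i)}=\mathcal{A}^{(i)}\mathcal{B}^{(i)}$. For invertible $M\in\mathbb{K}^{p\times p}$: $\mathcal{A}*_M\mathcal{B}=((\mathcal{A}\times_3 M)\triangle(\mathcal{B}\times_3 M))\times_3 M^{-1}$; this product is associative. The $*_M$-identity tensor $\mathcal{I}\in\mathbb{K}^{n\times n\times p}$ is the tensor for which every frontal slice of $\mathcal{I}\times_3M$ is $I_n$; it is a two-sided identity for $*_M$. $\mathcal{A}^{-1}$ denotes the (unique) tensor with $\mathcal{A}*_M\mathcal{A}^{-1}=\mathcal{A}^{-1}*_M\mathcal{A}=\mathcal{I}$,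 when it exists. $\mathcal{A}\in\mathbb{K}^{n\times n\times p}$ is $*_M$-pseudo-positive-definite if $(\mathcal{A}\times_3M)^{(i)}$ is Hermitian positive-definite (symmetric positive-definite if $\mathbb{K}=\mathbb{R}$) for all $i\in\{1,\dots,p\}$. Such a tensor is $*_M$-invertible and has a unique $*_M$-pseudo-positive-definite square root, denoted $\mathcal{A}^{1/2}$ (i.e. $\mathcal{A}^{1/2}*_M\mathcal{A}^{1/2}=\mathcal{A}$); $\mathcal{A}^{-1/2}=(\mathcal{A}^{1/2})^{-1}$. The geometric mean of $*_M$-pseudo-positive-definite $\mathcal{A},\mathcal{B}$ is $$\mathcal{A}\#_{*_M}\mathcal{B}=\mathcal{A}^{\frac12}*_M(\mathcal{A}^{-\frac12}*_M\mathcal{B}*_M\mathcal{A}^{-\frac12})^{\frac12}*_M\mathcal{A}^{\frac12}.$$ *)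

theory Defs
  imports "HOL-Analysis.Analysis" "Jordan_Normal_Form.Conjugate"
begin

text \<open>
  A third-order tensor of size m x n x p is stored as the family of its p frontal slices, so
  the third mode comes first: the entry $a_{ijk}$ is \<open>A $ k $ i $ j\<close>, and the k-th
  frontal slice is the matrix \<open>A $ k\<close>.
\<close>

type_synonym ('a, 'm, 'n, 'p) tensor = "'a ^ 'n ^ 'm ^ 'p"

definition mode3_product ::
    "('a::semiring_1, 'm::finite, 'n::finite, 'p::finite) tensor \<Rightarrow> 'a ^ 'p ^ 'r::finite
      \<Rightarrow> ('a, 'm, 'n, 'r) tensor"  (infixl \<open>\<times>\<^sub>3\<close> 75)
  where "A \<times>\<^sub>3 N = (\<chi> k i j. \<Sum>l\<in>UNIV. N $ k $ l * A $ l $ i $ j)"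

definition facewise_product ::
    "('a::semiring_1, 'm::finite, 'n::finite, 'p::finite) tensor \<Rightarrow> ('a, 'n, 'q::finite, 'p) tensor
      \<Rightarrow> ('a, 'm, 'q, 'p) tensor"  (infixl \<open>\<triangle>\<close> 70)
  where "A \<triangle> B = (\<chi> k. A $ k ** B $ k)"

definition tensor_product ::
    "('a::semiring_1, 'm::finite, 'n::finite, 'p::finite) tensor \<Rightarrow> 'a ^ 'p ^ 'p
      \<Rightarrow> ('a, 'n, 'q::finite, 'p) tensor \<Rightarrow> ('a, 'm, 'q, 'p) tensor"
    (\<open>(_ \<star>\<^bsub>_\<^esub> _)\<close> [70, 0, 71] 70)
  where "A \<star>\<^bsub>M\<^esub> B = ((A \<times>\<^sub>3 M) \<triangle> (B \<times>\<^sub>3 M)) \<times>\<^sub>3 matrix_inv M"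

definition tensor_identity ::
    "'a::semiring_1 ^ 'p::finite ^ 'p \<Rightarrow> ('a, 'n::finite, 'n, 'p) tensor"
  where "tensor_identity M = (THE I. \<forall>k. (I \<times>\<^sub>3 M) $ k = mat 1)"

definition tensor_inverse ::
    "'a::semiring_1 ^ 'p::finite ^ 'p \<Rightarrow> ('a, 'n::finite, 'n, 'p) tensor \<Rightarrow> ('a, 'n, 'n, 'p) tensor"
  where "tensor_inverse M A =
    (THE B. A \<star>\<^bsub>M\<^esub> B = tensor_identity M \<and> B \<star>\<^bsub>M\<^esub> A = tensor_identity M)"

text \<open>
  For real matrices \<open>conjugate\<close> is the identity, so the next two notions become symmetry and
  symmetric positive definiteness. For complex matrices \<open>conjugate\<close> is \<open>cnj\<close>, and
  \<open>0 < z\<close> means that z is real and positive.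
\<close>

definition hermitian :: "'a::conjugate ^ 'n::finite ^ 'n \<Rightarrow> bool"
  where "hermitian A \<longleftrightarrow> (\<forall>i j. A $ i $ j = conjugate (A $ j $ i))"

definition positive_definite :: "'a::conjugatable_ordered_field ^ 'n::finite ^ 'n \<Rightarrow> bool"
  where "positive_definite A \<longleftrightarrow>
    hermitian A \<and> (\<forall>x. x \<noteq> 0 \<longrightarrow> 0 < (\<Sum>i\<in>UNIV. conjugate (x $ i) * (A *v x) $ i))"

definition pseudo_positive_definite ::
    "'a::conjugatable_ordered_field ^ 'p::finite ^ 'p \<Rightarrow> ('a, 'n::finite, 'n, 'p) tensor \<Rightarrow> bool"
  where "pseudo_positive_definite M A \<longleftrightarrow> (\<forall>k. positive_definite ((A \<times>\<^sub>3 M) $ k))"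

definition tensor_sqrt ::
    "'a::conjugatable_ordered_field ^ 'p::finite ^ 'p \<Rightarrow> ('a, 'n::finite, 'n, 'p) tensor
      \<Rightarrow> ('a, 'n, 'n, 'p) tensor"
  where "tensor_sqrt M A = (THE R. pseudo_positive_definite M R \<and> R \<star>\<^bsub>M\<^esub> R = A)"

definition geometric_mean ::
    "'a::conjugatable_ordered_field ^ 'p::finite ^ 'p \<Rightarrow> ('a, 'n::finite, 'n, 'p) tensor
      \<Rightarrow> ('a, 'n, 'n, 'p) tensor \<Rightarrow> ('a, 'n, 'n, 'p) tensor"
  where "geometric_mean M A B =
    (let S = tensor_sqrt M A; T = tensor_inverse M S
     in S \<star>\<^bsub>M\<^esub> tensor_sqrt M (T \<star>\<^bsub>M\<^esub> B \<star>\<^bsub>M\<^esub> T) \<star>\<^bsub>M\<^esub> S)"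

end

theory Submission
  imports Defs
begin

section \<open>Positive definite maps of a real Euclidean space and their square roots\<close>

text \<open>Linearity and self-adjointness are meant over the reals, so that one notion serves real
  and complex matrices alike. Self-adjointness is a separate clause because a positive real
  quadratic form does not imply it.\<close>

definition pos_def_map :: "('v::real_inner \<Rightarrow> 'v) \<Rightarrow> bool"
  where "pos_def_map f \<longleftrightarrow>
    linear f \<and> (\<forall>x y. f x \<bullet> y = x \<bullet> f y) \<and> (\<forall>x. x \<noteq> 0 \<longrightarrow> 0 < x \<bullet> f x)"

text \<open>The unit sphere is compact, so the quadratic form attains a minimum there, which is
  positive; homogeneity extends the bound to all vectors.\<close>

lemma pos_def_map_coercive:
  fixes f :: "'v::euclidean_space \<Rightarrow> 'v"
  assumes "pos_def_map f"
  obtains m where "0 < m" "\<And>x. m * (norm x)\<^sup>2 \<le> x \<bullet> f x"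
proof -
  have lin: "linear f" and pos: "\<And>x. x \<noteq> 0 \<Longrightarrow> 0 < x \<bullet> f x"
    using assms by (auto simp: pos_def_map_def)
  have "continuous_on (sphere 0 1) (\<lambda>x. x \<bullet> f x)"
    using lin by (intro continuous_intros linear_continuous_on) (simp add: linear_linear)
  then obtain u where u: "norm u = 1" and min: "\<And>x. norm x = 1 \<Longrightarrow> u \<bullet> f u \<le> x \<bullet> f x"
    using continuous_attains_inf[of "sphere (0::'v) 1" "\<lambda>x. x \<bullet> f x"] by auto
  show thesis
  proof
    show "0 < u \<bullet> f u" using u by (intro pos) auto
    show "(u \<bullet> f u) * (norm x)\<^sup>2 \<le> x \<bullet> f x" for x
    proof (cases "x = 0")
      case True
      then show ?thesis using lin by simp
    next
      case False
      have "u \<bullet> f u \<le> (x /\<^sub>R norm x) \<bullet> f (x /\<^sub>R norm x)"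
        using False by (intro min) simp
      also have "\<dots> = (x \<bullet> f x) / (norm x)\<^sup>2"
        using lin by (simp add: linear_cmul power2_eq_square divide_simps)
      finally show ?thesis using False by (simp add: pos_le_divide_eq)
    qed
  qed
qed

text \<open>With \<open>C = 1 - s f\<close> and \<open>s\<close> small enough that \<open>C\<close> has operator norm below 1,
  a fixed point \<open>Y\<close> of the contraction \<open>Y \<mapsto> (C + Y\<^sup>2) / 2\<close> satisfies \<open>(1 - Y)\<^sup>2 = s f\<close>.
  Keeping track of the maps that commute with \<open>f\<close> is what later makes the root linear over
  the scalar field and not only over the reals.\<close>

lemma pos_def_map_sqrt_exists:
  fixes f :: "'v::euclidean_space \<Rightarrow> 'v"
  assumes f: "pos_def_map f"
  obtains g where "pos_def_map g" "\<And>x. g (g x) = f x"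
    "\<And>h x. linear h \<Longrightarrow> (\<And>y. h (f y) = f (h y)) \<Longrightarrow> h (g x) = g (h x)"
proof -
  have lin: "linear f" and sa: "\<And>x y. f x \<bullet> y = x \<bullet> f y"
    using f by (auto simp: pos_def_map_def)
  obtain m where m: "0 < m" "\<And>x. m * (norm x)\<^sup>2 \<le> x \<bullet> f x"
    using pos_def_map_coercive[OF f] by blast
  obtain K where K: "0 < K" "\<And>x. norm (f x) \<le> K * norm x"
    using linear_bounded_pos[OF lin] by blast
  \<comment> \<open>The estimate below gives
    \<open>norm (x - s f x)^2 \<le> (1 - 2 s m + s^2 K^2) * norm x^2\<close>. The factor is smallest
    at \<open>s = m / K^2\<close>, where it equals \<open>1 - m^2 / K^2\<close>, the square of
    \<open>c\<close>.\<close>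
  define s where "s = m / K\<^sup>2"
  define c where "c = sqrt (1 - m\<^sup>2 / K\<^sup>2)"
  have s: "0 < s" using m K by (simp add: s_def)
  \<comment> \<open>A unit vector yields \<open>m \<le> K\<close>, so the radicand of
    \<open>c\<close> is nonnegative.\<close>
  obtain u :: 'v where u: "norm u = 1" using vector_choose_size[of 1] by auto
  have "m \<le> u \<bullet> f u" using m(2)[of u] u by simp
  also have "\<dots> \<le> K" using Cauchy_Schwarz_ineq2[of u "f u"] K(2)[of u] u by simp
  finally have "m\<^sup>2 / K\<^sup>2 \<le> 1" using m(1) K(1) by (simp add: power_mono)
  then have c: "0 \<le> c" "c < 1" and c2: "c\<^sup>2 = 1 - m\<^sup>2 / K\<^sup>2"
    using m(1) K(1) by (simp_all add: c_def)
  define C where "C = Blinfun (\<lambda>x. x - s *\<^sub>R f x)"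
  have C: "blinfun_apply C x = x - s *\<^sub>R f x" for x
    unfolding C_def using lin
    by (subst bounded_linear_Blinfun_apply)
      (auto intro!: linearI simp: linear_add linear_cmul algebra_simps simp flip: linear_conv_bounded_linear)
  have normC: "norm C \<le> c"
  proof (rule norm_blinfun_bound)
    fix x
    have "(norm (C x))\<^sup>2 = (norm x)\<^sup>2 - 2 * s * (x \<bullet> f x) + s\<^sup>2 * (norm (f x))\<^sup>2"
      unfolding C power2_norm_eq_inner
      by (simp add: inner_diff inner_commute power2_eq_square algebra_simps)
    also have "\<dots> \<le> (norm x)\<^sup>2 - 2 * s * (m * (norm x)\<^sup>2) + s\<^sup>2 * (K * norm x)\<^sup>2"
      using m(2)[of x] s K(2)[of x] by (intro add_mono diff_mono mult_left_mono power_mono) auto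
    also have "\<dots> = (c * norm x)\<^sup>2"
      unfolding power_mult_distrib c2 s_def
      using K(1) by (simp add: power2_eq_square field_simps)
    finally show "norm (C x) \<le> c * norm x"
      using c by (auto intro: power2_le_imp_le)
  qed (use c in simp)
  \<comment> \<open>\<open>S\<close> collects what the fixed point should inherit: norm at most
    \<open>c\<close>, self-adjointness, and commutation with every map that commutes with
    \<open>f\<close>. Each condition is closed and preserved by \<open>F\<close>.\<close>
  define H where "H = {h. linear h \<and> (\<forall>y. h (f y) = f (h y))}"
  define S where "S = {Y. norm Y \<le> c} \<inter> {Y. \<forall>x y. blinfun_apply Y x \<bullet> y = x \<bullet> blinfun_apply Y y} \<inter>
    (\<Inter>h\<in>H. {Y. \<forall>x. h (blinfun_apply Y x) = blinfun_apply Y (h x)})"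
  define F where "F Y = (1/2) *\<^sub>R (C + (Y o\<^sub>L Y))" for Y
  have F: "blinfun_apply (F Y) x = (1/2) *\<^sub>R (x - s *\<^sub>R f x + Y (Y x))" for Y x
    by (simp add: F_def C blinfun.bilinear_simps)
  have "closed {Y. \<forall>x. h (blinfun_apply Y x) = blinfun_apply Y (h x)}" if "h \<in> H" for h
  proof (intro closed_Collect_all closed_Collect_eq)
    show "continuous_on UNIV (\<lambda>Y. h (blinfun_apply Y x))" for x
      using that by (intro bounded_linear.continuous_on[of h] continuous_intros)
        (simp add: H_def linear_linear)
  qed (intro continuous_intros)
  moreover have "closed {Y. norm (Y :: 'v \<Rightarrow>\<^sub>L 'v) \<le> c}"
    "closed {Y. \<forall>x y. blinfun_apply Y x \<bullet> y = x \<bullet> blinfun_apply Y (y :: 'v)}"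
    by (intro closed_Collect_all closed_Collect_le closed_Collect_eq continuous_intros)+
  ultimately have "closed S"
    by (simp add: S_def closed_Int closed_INT)
  then have "complete S" by (simp add: complete_eq_closed)
  moreover have "0 \<in> S" using c by (auto simp: S_def H_def linear_0)
  moreover have "F ` S \<subseteq> S"
  proof safe
    fix Y assume "Y \<in> S"
    then have Y: "norm Y \<le> c" "\<And>x y. Y x \<bullet> y = x \<bullet> Y y" "\<And>h x. h \<in> H \<Longrightarrow> h (Y x) = Y (h x)"
      by (auto simp: S_def)
    have "norm (Y o\<^sub>L Y) \<le> norm Y * norm Y" by (rule norm_blinfun_compose)
    also have "\<dots> \<le> c * 1" using Y(1) c by (intro mult_mono) auto
    finally have "norm (C + (Y o\<^sub>L Y)) \<le> c + c" using normC by (intro norm_triangle_mono) auto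
    then have "norm (F Y) \<le> c" by (simp add: F_def)
    moreover have "F Y x \<bullet> y = x \<bullet> F Y y" for x y
      using Y(2) by (simp add: F sa inner_simps)
    moreover have "h (F Y x) = F Y (h x)" if "h \<in> H" for h x
      using that Y(3)[OF that] by (simp add: H_def F linear_cmul linear_add linear_diff)
    ultimately show "F Y \<in> S" by (simp add: S_def)
  qed
  \<comment> \<open>Noncommutative difference of squares:
    \<open>Y Y - Z Z = Y (Y - Z) + (Y - Z) Z\<close>. On the ball of radius \<open>c\<close> this
    makes \<open>F\<close> Lipschitz with constant \<open>c < 1\<close>.\<close>
  moreover have "dist (F Y) (F Z) \<le> c * dist Y Z" if "Y \<in> S" "Z \<in> S" for Y Z
  proof -
    have "F Y - F Z = (1/2) *\<^sub>R ((Y o\<^sub>L (Y - Z)) + ((Y - Z) o\<^sub>L Z))"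
      by (rule blinfun_eqI) (simp add: F blinfun.bilinear_simps algebra_simps)
    also have "norm \<dots> \<le> (1/2) * (norm Y * norm (Y - Z) + norm (Y - Z) * norm Z)"
      by (simp add: norm_triangle_mono norm_blinfun_compose)
    also have "\<dots> \<le> (1/2) * (c * norm (Y - Z) + norm (Y - Z) * c)"
      using that by (intro mult_left_mono add_mono mult_right_mono) (auto simp: S_def)
    finally show ?thesis by (simp add: dist_norm)
  qed
  ultimately obtain Y where Y: "Y \<in> S" "F Y = Y"
    using Banach_fix[of S c F] c by blast
  have nY: "norm Y \<le> c" and saY: "\<And>x y. Y x \<bullet> y = x \<bullet> Y y"
    and commY: "\<And>h x. linear h \<Longrightarrow> (\<And>y. h (f y) = f (h y)) \<Longrightarrow> h (Y x) = Y (h x)"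
    using Y(1) by (auto simp: S_def H_def)
  have YY: "Y (Y x) = 2 *\<^sub>R Y x - x + s *\<^sub>R f x" for x
  proof -
    have "2 *\<^sub>R Y x = 2 *\<^sub>R F Y x" by (simp add: Y(2))
    also have "\<dots> = x - s *\<^sub>R f x + Y (Y x)" by (simp add: F)
    finally show ?thesis by simp
  qed
  \<comment> \<open>By \<open>YY\<close>, the square of \<open>1 - Y\<close> is \<open>s f\<close>,
    hence the factor \<open>1 / sqrt s\<close>. Positivity of \<open>g\<close> comes from
    \<open>norm Y \<le> c < 1\<close>.\<close>
  define g where "g x = (1 / sqrt s) *\<^sub>R (x - Y x)" for x
  show thesis
  proof
    have "0 < x \<bullet> g x" if "x \<noteq> 0" for x
    proof -
      have "x \<bullet> Y x \<le> norm x * norm (Y x)" by (rule norm_cauchy_schwarz)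
      also have "\<dots> \<le> norm x * (c * norm x)"
        using norm_blinfun[of Y x] nY by (meson mult_left_mono mult_right_mono norm_ge_zero order_trans)
      also have "\<dots> < norm x * norm x" using that c by simp
      also have "\<dots> = x \<bullet> x" by (simp add: norm_eq_sqrt_inner)
      finally show ?thesis using s by (simp add: g_def inner_diff_right)
    qed
    moreover have "linear g"
      by (rule linearI) (simp_all add: g_def blinfun.bilinear_simps algebra_simps)
    moreover have "g x \<bullet> y = x \<bullet> g y" for x y
      by (simp add: g_def inner_diff saY)
    ultimately show "pos_def_map g" by (simp add: pos_def_map_def)
    show "g (g x) = f x" for x
      using s by (simp add: g_def blinfun.bilinear_simps YY algebra_simps flip: scaleR_add_left)
    show "h (g x) = g (h x)" if "linear h" "\<And>y. h (f y) = f (h y)" for h x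
      using that commY[of h x] by (simp add: g_def linear_cmul linear_diff)
  qed
qed

text \<open>With \<open>d = g - h\<close>, the identity \<open>g d + d h = g\<^sup>2 - h\<^sup>2 = 0\<close> gives
  \<open>tr (d g d) + tr (d h d) = 0\<close>, where both traces are nonnegative.\<close>

lemma pos_def_map_sqrt_unique:
  fixes g h :: "'v::euclidean_space \<Rightarrow> 'v"
  assumes g: "pos_def_map g" and h: "pos_def_map h" and eq: "\<And>x. g (g x) = h (h x)"
  shows "g = h"
proof -
  define d where "d x = g x - h x" for x
  have lin: "linear g" "linear h" using g h by (auto simp: pos_def_map_def)
  have sah: "h x \<bullet> y = x \<bullet> h y" for x y using h by (auto simp: pos_def_map_def)
  have sad: "d x \<bullet> y = x \<bullet> d y" for x y
    using g h by (simp add: d_def inner_diff pos_def_map_def)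
  have nonneg: "0 \<le> x \<bullet> g x" "0 \<le> x \<bullet> h x" for x
    using g h unfolding pos_def_map_def by (cases "x = 0"; force simp: less_imp_le)+
  have zero: "g (d x) + d (h x) = 0" for x
    using lin by (simp add: d_def linear_diff eq)
  \<comment> \<open>Cyclicity of the trace, \<open>tr (d d h) = tr (d h d)\<close>, obtained by
    expanding in the basis and exchanging the two sums.\<close>
  have cyc: "(\<Sum>b\<in>Basis. d b \<bullet> d (h b)) = (\<Sum>b\<in>Basis. d b \<bullet> h (d b))"
  proof -
    have "(\<Sum>b\<in>Basis. d b \<bullet> d (h b)) = (\<Sum>b\<in>Basis. \<Sum>c\<in>Basis. (d b \<bullet> c) * (d (h b) \<bullet> c))"
      by (intro sum.cong refl euclidean_inner)
    also have "\<dots> = (\<Sum>b\<in>Basis. \<Sum>c\<in>Basis. (d c \<bullet> b) * (h (d c) \<bullet> b))"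
      by (intro sum.cong refl arg_cong2[where f = "(*)"]) (metis sad sah inner_commute)+
    also have "\<dots> = (\<Sum>c\<in>Basis. d c \<bullet> h (d c))"
      by (subst sum.swap) (intro sum.cong refl euclidean_inner[symmetric])
    finally show ?thesis .
  qed
  have "0 = (\<Sum>b\<in>Basis. d b \<bullet> (g (d b) + d (h b)))" by (simp add: zero)
  also have "\<dots> = (\<Sum>b\<in>Basis. d b \<bullet> g (d b) + d b \<bullet> h (d b))"
    by (simp add: inner_add_right sum.distrib cyc)
  \<comment> \<open>A vanishing sum of nonnegative terms has only zero terms; definiteness of
    \<open>g\<close> then forces \<open>d b = 0\<close>.\<close>
  finally have "\<forall>b\<in>Basis. d b \<bullet> g (d b) + d b \<bullet> h (d b) = 0"
    using nonneg by (subst (asm) eq_commute, subst (asm) sum_nonneg_eq_0_iff) (auto intro: add_nonneg_nonneg)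
  then have "d b = 0" if "b \<in> Basis" for b
    using that nonneg g unfolding pos_def_map_def
    by (metis add_nonneg_eq_0_iff less_irrefl)
  then have "g b = h b" if "b \<in> Basis" for b
    using that by (simp add: d_def)
  then show ?thesis using lin by (intro ext) (metis linear_eq_stdbasis)
qed

section \<open>Positive definite matrices over the real and complex fields\<close>

text \<open>Both scalar fields are treated at once by viewing \<open>K\<^sup>n\<close> as a real Euclidean space: its real
  inner product is the real part of the Hermitian form, and \<open>1 \<bullet> z\<close> is the real part of \<open>z\<close>.\<close>

class inner_conjugatable_field = conjugatable_ordered_field + real_normed_field + euclidean_space +
  assumes inner_eq_conjugate: "x \<bullet> y = 1 \<bullet> (conjugate x * y)"
    and pos_iff_inner: "0 < x \<longleftrightarrow> conjugate x = x \<and> 0 < 1 \<bullet> x"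

instance real :: inner_conjugatable_field
  by standard auto

instance complex :: inner_conjugatable_field
  by standard (auto simp: inner_complex_def less_complex_def complex_eq_iff)

lemma inner_vec_eq_conjugate:
  fixes x y :: "'a::inner_conjugatable_field ^ 'n::finite"
  shows "x \<bullet> y = 1 \<bullet> (\<Sum>i\<in>UNIV. conjugate (x $ i) * y $ i)"
  by (simp only: inner_vec_def inner_sum_right inner_eq_conjugate[symmetric])

lemma hermitian_iff_selfadjoint:
  fixes A :: "'a::inner_conjugatable_field ^ 'n::finite ^ 'n"
  shows "hermitian A \<longleftrightarrow> (\<forall>x y. (A *v x) \<bullet> y = x \<bullet> (A *v y))"
proof
  assume A: "hermitian A"
  have conj: "conjugate (A $ i $ j) = A $ j $ i" for i j
    using A unfolding hermitian_def by metis
  show "\<forall>x y. (A *v x) \<bullet> y = x \<bullet> (A *v y)"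
  proof (intro allI)
    fix x y
    have "(\<Sum>i\<in>UNIV. conjugate ((A *v x) $ i) * y $ i)
      = (\<Sum>i\<in>UNIV. \<Sum>j\<in>UNIV. conjugate (A $ i $ j) * conjugate (x $ j) * y $ i)"
      by (simp add: matrix_vector_mult_def sum_conjugate conjugate_dist_mul sum_distrib_right)
    also have "\<dots> = (\<Sum>i\<in>UNIV. \<Sum>j\<in>UNIV. A $ j $ i * conjugate (x $ j) * y $ i)"
      by (simp only: conj)
    also have "\<dots> = (\<Sum>j\<in>UNIV. conjugate (x $ j) * (A *v y) $ j)"
      by (subst sum.swap) (simp add: matrix_vector_mult_def sum_distrib_left mult_ac)
    finally show "(A *v x) \<bullet> y = x \<bullet> (A *v y)"
      by (simp only: inner_vec_eq_conjugate)
  qed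
next
  assume sa: "\<forall>x y. (A *v x) \<bullet> y = x \<bullet> (A *v y)"
  have col: "A *v axis j a = (\<chi> i. A $ i $ j * a)" for j a
    by (vector matrix_vector_mult_def axis_def) (simp add: if_distrib cong: if_cong)
  \<comment> \<open>The real inner product sees only real parts. Testing against
    \<open>axis i a\<close> for every scalar \<open>a\<close>, not just for 1, recovers the full
    entry.\<close>
  have "A $ i $ j \<bullet> a = conjugate (A $ j $ i) \<bullet> a" for i j a
  proof -
    have "A $ i $ j \<bullet> a = (A *v axis j 1) \<bullet> axis i a"
      by (simp add: inner_axis col)
    also have "\<dots> = axis j 1 \<bullet> (A *v axis i a)" using sa by blast
    also have "\<dots> = 1 \<bullet> (A $ j $ i * a)" by (simp add: inner_axis' col)
    also have "\<dots> = conjugate (A $ j $ i) \<bullet> a"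
      by (subst inner_eq_conjugate[of "conjugate _"]) simp
    finally show ?thesis .
  qed
  then show "hermitian A"
    unfolding hermitian_def using vector_eq_rdot by blast
qed

text \<open>The form of a Hermitian matrix is fixed by conjugation, so its positivity as a scalar is
  that of its real part. For a non-Hermitian matrix both sides fail.\<close>

lemma positive_definite_iff_pos_def_map:
  fixes A :: "'a::inner_conjugatable_field ^ 'n::finite ^ 'n"
  shows "positive_definite A \<longleftrightarrow> pos_def_map ((*v) A)"
proof (cases "hermitian A")
  case True
  have conj: "conjugate (A $ i $ j) = A $ j $ i" for i j
    using True unfolding hermitian_def by metis
  have "conjugate (\<Sum>i\<in>UNIV. conjugate (x $ i) * (A *v x) $ i)
    = (\<Sum>i\<in>UNIV. conjugate (x $ i) * (A *v x) $ i)" for x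
  proof -
    have "conjugate (\<Sum>i\<in>UNIV. conjugate (x $ i) * (A *v x) $ i)
      = (\<Sum>i\<in>UNIV. \<Sum>j\<in>UNIV. x $ i * (conjugate (A $ i $ j) * conjugate (x $ j)))"
      by (simp add: matrix_vector_mult_def sum_conjugate conjugate_dist_mul sum_distrib_left)
    also have "\<dots> = (\<Sum>i\<in>UNIV. \<Sum>j\<in>UNIV. x $ i * (A $ j $ i * conjugate (x $ j)))"
      by (simp only: conj)
    also have "\<dots> = (\<Sum>i\<in>UNIV. conjugate (x $ i) * (A *v x) $ i)"
      by (subst sum.swap) (simp add: matrix_vector_mult_def sum_distrib_left mult_ac)
    finally show ?thesis .
  qed
  then have "0 < (\<Sum>i\<in>UNIV. conjugate (x $ i) * (A *v x) $ i) \<longleftrightarrow> 0 < x \<bullet> (A *v x)" for x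
    by (subst pos_iff_inner) (simp add: inner_vec_eq_conjugate)
  with True show ?thesis
    by (simp add: positive_definite_def pos_def_map_def hermitian_iff_selfadjoint)
next
  case False
  then show ?thesis
    by (auto simp: positive_definite_def pos_def_map_def hermitian_iff_selfadjoint)
qed

lemma positive_definite_invertible:
  fixes A :: "'a::inner_conjugatable_field ^ 'n::finite ^ 'n"
  assumes "positive_definite A"
  shows "invertible A"
proof -
  have "A *v x = 0 \<Longrightarrow> x = 0" for x
    using assms by (metis positive_definite_iff_pos_def_map pos_def_map_def inner_zero_right less_irrefl)
  then show ?thesis
    by (simp add: invertible_left_inverse matrix_left_invertible_ker)
qed

text \<open>With \<open>y = B *v x\<close> one has \<open>x = A *v y\<close>, so the form of
  \<open>B\<close> at \<open>x\<close> is the form of \<open>A\<close> at \<open>y\<close>.\<close>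

lemma positive_definite_inverse:
  fixes A :: "'a::inner_conjugatable_field ^ 'n::finite ^ 'n"
  assumes A: "positive_definite A" and AB: "A ** B = mat 1"
  shows "positive_definite B"
proof -
  have sa: "(A *v x) \<bullet> y = x \<bullet> (A *v y)" and pos: "x \<noteq> 0 \<Longrightarrow> 0 < x \<bullet> (A *v x)" for x y
    using A by (auto simp: positive_definite_iff_pos_def_map pos_def_map_def)
  have B: "A *v (B *v x) = x" for x
    by (simp add: matrix_vector_mul_assoc AB)
  have "0 < x \<bullet> (B *v x)" if "x \<noteq> 0" for x
    using pos[of "B *v x"] that B[of x] by (metis inner_commute matrix_vector_mult_0_right)
  moreover have "(B *v x) \<bullet> y = x \<bullet> (B *v y)" for x y
    by (metis B sa)
  ultimately show ?thesis
    by (simp add: positive_definite_iff_pos_def_map pos_def_map_def)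
qed

text \<open>Self-adjointness of \<open>T\<close> turns the form at \<open>x\<close> into that of
  \<open>P\<close> at \<open>T *v x\<close>, which is nonzero since \<open>T\<close> is
  definite.\<close>

lemma positive_definite_congruence:
  fixes P T :: "'a::inner_conjugatable_field ^ 'n::finite ^ 'n"
  assumes P: "positive_definite P" and T: "positive_definite T"
  shows "positive_definite (T ** P ** T)"
proof -
  have TPT: "(T ** P ** T) *v x = T *v (P *v (T *v x))" for x
    by (simp add: matrix_vector_mul_assoc matrix_mul_assoc)
  have saP: "(P *v x) \<bullet> y = x \<bullet> (P *v y)" and posP: "x \<noteq> 0 \<Longrightarrow> 0 < x \<bullet> (P *v x)"
    and saT: "(T *v x) \<bullet> y = x \<bullet> (T *v y)" and posT: "x \<noteq> 0 \<Longrightarrow> 0 < x \<bullet> (T *v x)" for x y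
    using P T by (auto simp: positive_definite_iff_pos_def_map pos_def_map_def)
  have "0 < x \<bullet> (T *v (P *v (T *v x)))" if "x \<noteq> 0" for x
    using that posT[of x] posP[of "T *v x"] by (metis inner_zero_right less_irrefl saT)
  moreover have "(T *v (P *v (T *v x))) \<bullet> y = x \<bullet> (T *v (P *v (T *v y)))" for x y
    by (simp only: saP saT)
  ultimately show ?thesis
    by (simp add: positive_definite_iff_pos_def_map pos_def_map_def TPT)
qed

lemma positive_definite_sqrt_ex1:
  fixes A :: "'a::inner_conjugatable_field ^ 'n::finite ^ 'n"
  assumes A: "positive_definite A"
  shows "\<exists>!R. positive_definite R \<and> R ** R = A"
proof (rule ex_ex1I)
  obtain g where g: "pos_def_map g" "\<And>x. g (g x) = A *v x"
    and comm: "\<And>h x. linear h \<Longrightarrow> (\<And>y. h (A *v y) = A *v h y) \<Longrightarrow> h (g x) = g (h x)"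
    using pos_def_map_sqrt_exists[OF A[unfolded positive_definite_iff_pos_def_map]] by blast
  \<comment> \<open>So far \<open>g\<close> is only real-linear. Scaling by \<open>a\<close> is a
    real-linear map commuting with \<open>A\<close>, hence with \<open>g\<close>; thus
    \<open>g\<close> is linear over the field and given by a matrix.\<close>
  have "g (a *s x) = a *s g x" for a x
  proof (rule comm[symmetric])
    show "linear ((*s) a)"
      by (rule linearI) (vector algebra_simps)+
  qed (simp add: vector_scalar_commute)
  moreover have "g (x + y) = g x + g y" for x y
    using g(1) by (auto simp: pos_def_map_def linear_add)
  ultimately have "Vector_Spaces.linear (*s) (*s) g"
    by unfold_locales auto
  then have "(*v) (matrix g) = g"
    by (intro ext matrix_works)
  with g have "positive_definite (matrix g)" "matrix g ** matrix g = A"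
    by (simp_all add: positive_definite_iff_pos_def_map matrix_eq flip: matrix_vector_mul_assoc)
  then show "\<exists>R. positive_definite R \<and> R ** R = A" by blast
next
  fix R S :: "'a ^ 'n ^ 'n"
  assume "positive_definite R \<and> R ** R = A" "positive_definite S \<and> S ** S = A"
  then have "(*v) R = (*v) S"
    by (intro pos_def_map_sqrt_unique)
      (auto simp: positive_definite_iff_pos_def_map matrix_vector_mul_assoc)
  then show "R = S" by (simp add: matrix_eq)
qed

section \<open>The tensor product seen through transformed frontal slices\<close>

lemma mode3_product_assoc: "A \<times>\<^sub>3 N \<times>\<^sub>3 P = A \<times>\<^sub>3 (P ** N)"
  for N :: "'a::comm_semiring_1 ^ 'p::finite ^ 'q::finite"
  by (simp add: mode3_product_def matrix_matrix_mult_def vec_eq_iff sum_distrib_left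
      sum_distrib_right mult.assoc) (intro allI, rule sum.swap)

lemma mode3_product_mat_1 [simp]: "A \<times>\<^sub>3 mat 1 = A"
  by (simp add: mode3_product_def mat_def vec_eq_iff mult_delta_left)

lemma matrix_inv_cancel:
  assumes "invertible M"
  shows "M ** matrix_inv M = mat 1" "matrix_inv M ** M = mat 1"
proof -
  have "M ** matrix_inv M = mat 1 \<and> matrix_inv M ** M = mat 1"
    using assms unfolding invertible_def matrix_inv_def by (rule someI_ex)
  then show "M ** matrix_inv M = mat 1" "matrix_inv M ** M = mat 1" by simp_all
qed

context
  fixes M :: "'a::inner_conjugatable_field ^ 'p::finite ^ 'p"
  assumes M: "invertible M"
begin

lemma mode3_product_inv [simp]:
  "A \<times>\<^sub>3 matrix_inv M \<times>\<^sub>3 M = A" "A \<times>\<^sub>3 M \<times>\<^sub>3 matrix_inv M = A"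
  by (simp_all add: mode3_product_assoc matrix_inv_cancel[OF M])

text \<open>The transform by an invertible \<open>M\<close> is injective. Together with
  \<open>tensor_product_slice\<close> this reduces tensor identities to matrix identities, slice by
  slice.\<close>

lemma tensor_eq_iff_slices: "A = B \<longleftrightarrow> (\<forall>k. (A \<times>\<^sub>3 M) $ k = (B \<times>\<^sub>3 M) $ k)"
proof
  assume "\<forall>k. (A \<times>\<^sub>3 M) $ k = (B \<times>\<^sub>3 M) $ k"
  then have "A \<times>\<^sub>3 M \<times>\<^sub>3 matrix_inv M = B \<times>\<^sub>3 M \<times>\<^sub>3 matrix_inv M"
    by (subst (asm) vec_eq_iff[symmetric]) simp
  then show "A = B" by simp
qed simp

lemma tensor_product_slice [simp]:
  "((A \<star>\<^bsub>M\<^esub> B) \<times>\<^sub>3 M) $ k = (A \<times>\<^sub>3 M) $ k ** (B \<times>\<^sub>3 M) $ k"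
  by (simp add: tensor_product_def facewise_product_def)

lemma tensor_product_assoc: "(A \<star>\<^bsub>M\<^esub> B) \<star>\<^bsub>M\<^esub> C = A \<star>\<^bsub>M\<^esub> (B \<star>\<^bsub>M\<^esub> C)"
  by (simp add: tensor_eq_iff_slices matrix_mul_assoc)

lemma tensor_identity_slice [simp]: "(tensor_identity M \<times>\<^sub>3 M) $ k = mat 1"
proof -
  have "\<exists>!I :: ('a, 'n::finite, 'n, 'p) tensor. \<forall>k. (I \<times>\<^sub>3 M) $ k = mat 1"
  proof (rule ex_ex1I)
    have "\<forall>k. ((\<chi> _. mat 1) \<times>\<^sub>3 matrix_inv M \<times>\<^sub>3 M) $ k = (mat 1 :: 'a ^ 'n ^ 'n)" by simp
    then show "\<exists>I :: ('a, 'n, 'n, 'p) tensor. \<forall>k. (I \<times>\<^sub>3 M) $ k = mat 1" by blast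
  qed (simp add: tensor_eq_iff_slices)
  from theI'[OF this] show ?thesis unfolding tensor_identity_def by blast
qed

lemma tensor_identity_neutral [simp]:
  "tensor_identity M \<star>\<^bsub>M\<^esub> A = A" "A \<star>\<^bsub>M\<^esub> tensor_identity M = A"
  by (simp_all add: tensor_eq_iff_slices)

text \<open>Two-sided inverses coincide by associativity, so the definite description denotes any
  inverse that has been exhibited.\<close>

lemma tensor_inverse_eqI:
  assumes "A \<star>\<^bsub>M\<^esub> B = tensor_identity M" "B \<star>\<^bsub>M\<^esub> A = tensor_identity M"
  shows "tensor_inverse M A = B"
  unfolding tensor_inverse_def
proof (rule the_equality)
  show "C = B" if "A \<star>\<^bsub>M\<^esub> C = tensor_identity M \<and> C \<star>\<^bsub>M\<^esub> A = tensor_identity M" for C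
    using assms that by (metis tensor_identity_neutral tensor_product_assoc)
qed (use assms in simp)

section \<open>Inverses, congruences and square roots of pseudo-positive-definite tensors\<close>

lemma pseudo_positive_definite_inverse:
  assumes A: "pseudo_positive_definite M A"
  shows "A \<star>\<^bsub>M\<^esub> tensor_inverse M A = tensor_identity M"
    and "tensor_inverse M A \<star>\<^bsub>M\<^esub> A = tensor_identity M"
    and "pseudo_positive_definite M (tensor_inverse M A)"
proof -
  \<comment> \<open>The slices are inverted one by one in the transformed domain, and the result is
    pulled back by \<open>matrix_inv M\<close>.\<close>
  define B where "B = (\<chi> k. matrix_inv ((A \<times>\<^sub>3 M) $ k)) \<times>\<^sub>3 matrix_inv M"
  have pd: "positive_definite ((A \<times>\<^sub>3 M) $ k)" for k
    using A by (simp add: pseudo_positive_definite_def)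
  note inv = matrix_inv_cancel[OF positive_definite_invertible[OF pd]]
  have AB: "A \<star>\<^bsub>M\<^esub> B = tensor_identity M" "B \<star>\<^bsub>M\<^esub> A = tensor_identity M"
    by (simp_all add: tensor_eq_iff_slices B_def inv)
  have "pseudo_positive_definite M B"
    using positive_definite_inverse[OF pd inv(1)]
    by (simp add: pseudo_positive_definite_def B_def)
  with AB tensor_inverse_eqI[OF AB]
  show "A \<star>\<^bsub>M\<^esub> tensor_inverse M A = tensor_identity M"
    and "tensor_inverse M A \<star>\<^bsub>M\<^esub> A = tensor_identity M"
    and "pseudo_positive_definite M (tensor_inverse M A)"
    by simp_all
qed

lemma pseudo_positive_definite_congruence:
  assumes "pseudo_positive_definite M P" "pseudo_positive_definite M T"
  shows "pseudo_positive_definite M (T \<star>\<^bsub>M\<^esub> P \<star>\<^bsub>M\<^esub> T)"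
  using assms by (simp add: pseudo_positive_definite_def positive_definite_congruence)

text \<open>Existence and uniqueness of the matrix root on each slice lift to tensors. The
  equivalence both specifies \<open>tensor_sqrt\<close> and identifies any candidate root with
  it.\<close>

lemma tensor_sqrt_iff:
  assumes A: "pseudo_positive_definite M A"
  shows "pseudo_positive_definite M R \<and> R \<star>\<^bsub>M\<^esub> R = A \<longleftrightarrow> R = tensor_sqrt M A"
proof -
  have ex1: "\<exists>!R. positive_definite R \<and> R ** R = (A \<times>\<^sub>3 M) $ k" for k
    using A by (intro positive_definite_sqrt_ex1) (simp add: pseudo_positive_definite_def)
  then obtain r where r: "positive_definite (r k)" "r k ** r k = (A \<times>\<^sub>3 M) $ k" for k
    by metis
  define R\<^sub>0 where "R\<^sub>0 = (\<chi> k. r k) \<times>\<^sub>3 matrix_inv M"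
  have "pseudo_positive_definite M R\<^sub>0 \<and> R\<^sub>0 \<star>\<^bsub>M\<^esub> R\<^sub>0 = A"
    by (simp add: R\<^sub>0_def r pseudo_positive_definite_def tensor_eq_iff_slices)
  moreover have "R = R\<^sub>0" if "pseudo_positive_definite M R \<and> R \<star>\<^bsub>M\<^esub> R = A" for R
  proof -
    have "(R \<times>\<^sub>3 M) $ k = r k" for k
    proof -
      have "positive_definite ((R \<times>\<^sub>3 M) $ k)"
        using that by (simp add: pseudo_positive_definite_def)
      moreover have "(R \<times>\<^sub>3 M) $ k ** (R \<times>\<^sub>3 M) $ k = (A \<times>\<^sub>3 M) $ k"
        using that by (metis tensor_product_slice)
      ultimately show ?thesis using ex1[of k] r[of k] by blast
    qed
    then show ?thesis by (simp add: tensor_eq_iff_slices R\<^sub>0_def)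
  qed
  ultimately have sqrt: "\<exists>!R. pseudo_positive_definite M R \<and> R \<star>\<^bsub>M\<^esub> R = A" by blast
  have "pseudo_positive_definite M (tensor_sqrt M A) \<and> tensor_sqrt M A \<star>\<^bsub>M\<^esub> tensor_sqrt M A = A"
    unfolding tensor_sqrt_def by (rule theI'[OF sqrt])
  with sqrt show ?thesis by blast
qed

section \<open>The Riccati equation\<close>

text \<open>With \<open>S = A\<^bsup>1/2\<^esup>\<close> and \<open>T = A\<^bsup>-1/2\<^esup>\<close>, multiplying \<open>X A\<^bsup>-1\<^esup> X = B\<close> by \<open>T\<close> on both sides
  turns it into \<open>(T X T)\<^sup>2 = T B T\<close>, so that \<open>T X T\<close> is the square root of \<open>T B T\<close>.\<close>

theorem riccati_iff_geometric_mean: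
  fixes A B X :: "('a, 'n::finite, 'n, 'p) tensor"
  assumes A: "pseudo_positive_definite M A" and B: "pseudo_positive_definite M B"
  shows "pseudo_positive_definite M X \<and> X \<star>\<^bsub>M\<^esub> tensor_inverse M A \<star>\<^bsub>M\<^esub> X = B
    \<longleftrightarrow> X = geometric_mean M A B"
proof -
  define S where "S = tensor_sqrt M A"
  define T where "T = tensor_inverse M S"
  have S: "pseudo_positive_definite M S" "S \<star>\<^bsub>M\<^esub> S = A"
    using tensor_sqrt_iff[OF A] by (auto simp: S_def)
  have T: "pseudo_positive_definite M T"
    and ST: "S \<star>\<^bsub>M\<^esub> T = tensor_identity M" and TS: "T \<star>\<^bsub>M\<^esub> S = tensor_identity M"
    using pseudo_positive_definite_inverse[OF S(1)] by (auto simp: T_def)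
  have ST': "S \<star>\<^bsub>M\<^esub> (T \<star>\<^bsub>M\<^esub> Z) = Z" and TS': "T \<star>\<^bsub>M\<^esub> (S \<star>\<^bsub>M\<^esub> Z) = Z" for Z :: "('a, 'n, 'n, 'p) tensor"
    by (simp_all add: ST TS flip: tensor_product_assoc)
  note cancel = tensor_product_assoc ST TS ST' TS'
  have inv: "tensor_inverse M A = T \<star>\<^bsub>M\<^esub> T"
    by (rule tensor_inverse_eqI) (simp_all add: cancel flip: S(2))
  \<comment> \<open>Congruence by \<open>T\<close> is undone by congruence by \<open>S\<close>, so
    it is a bijection and equations may be moved across it.\<close>
  have eq_iff: "T \<star>\<^bsub>M\<^esub> U \<star>\<^bsub>M\<^esub> T = V \<longleftrightarrow> U = S \<star>\<^bsub>M\<^esub> V \<star>\<^bsub>M\<^esub> S" for U V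
    by (auto simp: cancel)
  have "pseudo_positive_definite M X \<longleftrightarrow> pseudo_positive_definite M (T \<star>\<^bsub>M\<^esub> X \<star>\<^bsub>M\<^esub> T)"
    using pseudo_positive_definite_congruence[OF _ T]
      pseudo_positive_definite_congruence[OF _ S(1), of "T \<star>\<^bsub>M\<^esub> X \<star>\<^bsub>M\<^esub> T"]
    by (auto simp: cancel)
  \<comment> \<open>Since \<open>T T\<close> is the inverse of \<open>A\<close>, the square of
    \<open>T X T\<close> is \<open>T (X A^-1 X) T\<close>, and congruence by \<open>T\<close> is
    injective.\<close>
  moreover have "X \<star>\<^bsub>M\<^esub> tensor_inverse M A \<star>\<^bsub>M\<^esub> X = B \<longleftrightarrow>
      (T \<star>\<^bsub>M\<^esub> X \<star>\<^bsub>M\<^esub> T) \<star>\<^bsub>M\<^esub> (T \<star>\<^bsub>M\<^esub> X \<star>\<^bsub>M\<^esub> T) = T \<star>\<^bsub>M\<^esub> B \<star>\<^bsub>M\<^esub> T"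
    using eq_iff[of "X \<star>\<^bsub>M\<^esub> tensor_inverse M A \<star>\<^bsub>M\<^esub> X" "T \<star>\<^bsub>M\<^esub> B \<star>\<^bsub>M\<^esub> T"]
    by (simp add: inv cancel)
  ultimately show ?thesis
    using tensor_sqrt_iff[OF pseudo_positive_definite_congruence[OF B T], of "T \<star>\<^bsub>M\<^esub> X \<star>\<^bsub>M\<^esub> T"]
    by (simp add: eq_iff geometric_mean_def Let_def flip: S_def T_def)
qed

end

text \<open>Read from right to left, the equivalence says that the geometric mean is a solution;
  from left to right, that it is the only one. Both fields are instances of the same class.\<close>

theorem theorem4p1:
  shows "(\<forall>(M :: real ^ 'p::finite ^ 'p) (A :: (real, 'n::finite, 'n, 'p) tensor) B.
            invertible M \<and> pseudo_positive_definite M A \<and> pseudo_positive_definite M B \<longrightarrow>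
            (\<forall>X. pseudo_positive_definite M X \<and> X \<star>\<^bsub>M\<^esub> tensor_inverse M A \<star>\<^bsub>M\<^esub> X = B
                 \<longleftrightarrow> X = geometric_mean M A B)) \<and>
         (\<forall>(M :: complex ^ 'p ^ 'p) (A :: (complex, 'n, 'n, 'p) tensor) B.
            invertible M \<and> pseudo_positive_definite M A \<and> pseudo_positive_definite M B \<longrightarrow>
            (\<forall>X. pseudo_positive_definite M X \<and> X \<star>\<^bsub>M\<^esub> tensor_inverse M A \<star>\<^bsub>M\<^esub> X = B
                 \<longleftrightarrow> X = geometric_mean M A B))"
  by (intro conjI allI impI; elim conjE; rule riccati_iff_geometric_mean; assumption)

end
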